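(* Let $L$ be a decomposable lattice. The following conditions are equivalent: (1) $Spe(L)=V(L)$. (2) $V(L)$ (ordered by inclusion) satisfies the descending chain condition. (3) $Spe(L)$ (ordered by inclusion) satisfies the descending chain condition.
   Context: A decomposable lattice is a distributive lattice $L$ with minimum element $0$ such that for any $a,b\in L$ that are not comparable there exist $\overline{a},\overline{b}\in L$ with $a=\overline{a}\vee(a\wedge b)$, $b=\overline{b}\vee(a\wedge b)$ and $\overline{a}\wedge\overline{b}=0$. An ideal of $L$ is a nonempty subset closed under $\vee$ and downward closed. An ideal $P$ is prime if $P\neq L$ and $a\wedge b\in P$ implies $a\in P$ or $b\in P$; $Spe(L)$ is the set of all prime ideals. For $0<x\in L$, a value of $x$ is an ideal of $L$ maximal (under inclusion) among the ideals not containing $x$. $V(L)$ is the set of all ideals that are values of some $0<x\in L$ (the regular ideals). *)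

theory Defs
  imports Main
begin

class decomposable_lattice = distrib_lattice + bounded_lattice_bot +
  assumes decomposable:
    "\<not> a \<le> b \<Longrightarrow> \<not> b \<le> a \<Longrightarrow>
      \<exists>a' b'. a = sup a' (inf a b) \<and> b = sup b' (inf a b) \<and> inf a' b' = bot"

definition lattice_ideal :: "'a::lattice set \<Rightarrow> bool" where
  "lattice_ideal I \<longleftrightarrow>
     I \<noteq> {} \<and> (\<forall>a\<in>I. \<forall>b\<in>I. sup a b \<in> I) \<and> (\<forall>a\<in>I. \<forall>b. b \<le> a \<longrightarrow> b \<in> I)"

definition prime_lattice_ideal :: "'a::lattice set \<Rightarrow> bool" where
  "prime_lattice_ideal P \<longleftrightarrow>
     lattice_ideal P \<and> P \<noteq> UNIV \<and> (\<forall>a b. inf a b \<in> P \<longrightarrow> a \<in> P \<or> b \<in> P)"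

definition Spe :: "'a::lattice set set" where
  "Spe = {P. prime_lattice_ideal P}"

definition is_value :: "'a::lattice \<Rightarrow> 'a set \<Rightarrow> bool" where
  "is_value x P \<longleftrightarrow>
     lattice_ideal P \<and> x \<notin> P \<and>
     (\<forall>Q. lattice_ideal Q \<and> x \<notin> Q \<and> P \<subseteq> Q \<longrightarrow> Q = P)"

definition Val :: "'a::bounded_lattice_bot set set" where
  "Val = {P. \<exists>x. bot < x \<and> is_value x P}"

text \<open>For a family of ideals the order is that of \<open>'a set\<close>, i.e. inclusion.\<close>

definition dcc :: "'a::order set \<Rightarrow> bool" where
  "dcc S \<longleftrightarrow>
     (\<forall>f :: nat \<Rightarrow> 'a. range f \<subseteq> S \<longrightarrow> antimono f \<longrightarrow> (\<exists>n. \<forall>m\<ge>n. f m = f n))"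

end

theory Submission
  imports Defs
begin

text \<open>
  Two facts hold for every distributive lattice with minimum: values are prime, and every ideal
  that misses \<open>x\<close> extends to a value of \<open>x\<close> (Zorn's lemma).  Decomposability enters only
  through the fact that the ideals above a given prime form a chain.

  Suppose that \<open>V(L)\<close> satisfies the descending chain condition and let \<open>P\<close> be prime.  The values
  containing \<open>P\<close> form a chain, so they have a least member \<open>M\<close>.  An element \<open>x\<close> of \<open>M\<close> outside
  \<open>P\<close> would have a value containing \<open>P\<close>; this value contains \<open>M\<close> and hence \<open>x\<close>, a contradiction.
  So \<open>P = M\<close> is a value.

  Conversely, suppose that every prime is a value.  The intersection of a descending sequence of
  primes is prime, hence a value of some \<open>x\<close>.  As \<open>x\<close> lies outside the intersection, it lies
  outside some term of the sequence, and by maximality that term is the intersection.  So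
  \<open>Spe(L)\<close> satisfies the descending chain condition, and then so does its subset \<open>V(L)\<close>.
\<close>

section \<open>Ideals and values\<close>

lemma lattice_idealD:
  assumes "lattice_ideal I"
  shows "I \<noteq> {}" "\<And>a b. a \<in> I \<Longrightarrow> b \<in> I \<Longrightarrow> sup a b \<in> I" "\<And>a b. a \<in> I \<Longrightarrow> b \<le> a \<Longrightarrow> b \<in> I"
  using assms by (auto simp: lattice_ideal_def)

lemma bot_in_lattice_ideal:
  fixes I :: "'a::bounded_lattice_bot set"
  assumes "lattice_ideal I"
  shows "bot \<in> I"
  using lattice_idealD[OF assms] by (meson bot.extremum ex_in_conv)

lemma lattice_ideal_Union_chain:
  assumes "C \<noteq> {}" and "\<And>I. I \<in> C \<Longrightarrow> lattice_ideal I"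
    and chain: "\<And>I J. I \<in> C \<Longrightarrow> J \<in> C \<Longrightarrow> I \<subseteq> J \<or> J \<subseteq> I"
  shows "lattice_ideal (\<Union>C)"
  unfolding lattice_ideal_def
proof (intro conjI ballI allI impI)
  show "\<Union>C \<noteq> {}"
    using assms(1) lattice_idealD(1)[OF assms(2)] by blast
next
  fix a b assume "a \<in> \<Union>C" "b \<in> \<Union>C"
  then obtain I J where IJ: "I \<in> C" "a \<in> I" "J \<in> C" "b \<in> J" by blast
  then obtain K where "K \<in> C" "a \<in> K" "b \<in> K" using chain[of I J] by blast
  then have "sup a b \<in> K" by (intro lattice_idealD(2)[OF assms(2)])
  with \<open>K \<in> C\<close> show "sup a b \<in> \<Union>C" by blast
next
  fix a b assume "a \<in> \<Union>C" "b \<le> a"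
  then obtain I where I: "I \<in> C" "a \<in> I" by blast
  then have "b \<in> I" using \<open>b \<le> a\<close> by (rule lattice_idealD(3)[OF assms(2)])
  with I show "b \<in> \<Union>C" by blast
qed

lemma ex_value_above_ideal:
  assumes "lattice_ideal I" and "x \<notin> I"
  shows "\<exists>M. is_value x M \<and> I \<subseteq> M"
proof -
  let ?A = "{J. lattice_ideal J \<and> x \<notin> J \<and> I \<subseteq> J}"
  have "\<exists>M\<in>?A. \<forall>J\<in>?A. M \<subseteq> J \<longrightarrow> J = M"
  proof (rule subset_Zorn_nonempty)
    show "?A \<noteq> {}" using assms by blast
  next
    fix C assume "C \<noteq> {}" and C: "subset.chain ?A C"
    then have "lattice_ideal (\<Union>C)"
      by (intro lattice_ideal_Union_chain) (auto simp: subset_chain_def)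
    with \<open>C \<noteq> {}\<close> C show "\<Union>C \<in> ?A" by (auto simp: subset_chain_def)
  qed
  then obtain M where M: "M \<in> ?A" and maximal: "\<forall>J\<in>?A. M \<subseteq> J \<longrightarrow> J = M"
    by (rule bexE)
  have "is_value x M"
    unfolding is_value_def
  proof (intro conjI allI impI)
    fix Q assume "lattice_ideal Q \<and> x \<notin> Q \<and> M \<subseteq> Q"
    with M show "Q = M" by (intro maximal[rule_format]) auto
  qed (use M in auto)
  with M show ?thesis by blast
qed

section \<open>Values are prime\<close>

text \<open>This set is the ideal generated by \<open>I\<close> and \<open>a\<close>.\<close>

lemma lattice_ideal_adjoin:
  assumes "lattice_ideal I"
  shows "lattice_ideal {y. \<exists>m\<in>I. y \<le> sup m a}"
  unfolding lattice_ideal_def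
proof (intro conjI ballI allI impI)
  show "{y. \<exists>m\<in>I. y \<le> sup m a} \<noteq> {}"
    using lattice_idealD(1)[OF assms] by blast
next
  fix y z assume "y \<in> {y. \<exists>m\<in>I. y \<le> sup m a}" "z \<in> {y. \<exists>m\<in>I. y \<le> sup m a}"
  then obtain m n where mn: "m \<in> I" "n \<in> I" and "y \<le> sup m a" "z \<le> sup n a" by blast
  have "y \<le> sup (sup m n) a" "z \<le> sup (sup m n) a"
    by (rule order_trans[OF \<open>y \<le> sup m a\<close>], simp add: le_supI1)
       (rule order_trans[OF \<open>z \<le> sup n a\<close>], simp add: le_supI1)
  then have "sup y z \<le> sup (sup m n) a"
    by (rule sup_least)
  moreover have "sup m n \<in> I" using mn by (rule lattice_idealD(2)[OF assms])
  ultimately show "sup y z \<in> {y. \<exists>m\<in>I. y \<le> sup m a}" by blast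
next
  fix y z assume "y \<in> {y. \<exists>m\<in>I. y \<le> sup m a}" "z \<le> y"
  then show "z \<in> {y. \<exists>m\<in>I. y \<le> sup m a}" using order_trans[of z y] by blast
qed

text \<open>
  A value \<open>M\<close> of \<open>x\<close> is maximal among the ideals without \<open>x\<close>, so the ideal generated by \<open>M\<close>
  and an \<open>a\<close> outside \<open>M\<close> contains \<open>x\<close>.
\<close>

lemma value_below_adjoin:
  assumes "is_value x M" and "a \<notin> M"
  shows "\<exists>m\<in>M. x \<le> sup m a"
proof (rule ccontr)
  let ?J = "{y. \<exists>m\<in>M. y \<le> sup m a}"
  assume "\<not> (\<exists>m\<in>M. x \<le> sup m a)"
  then have "x \<notin> ?J" by blast
  moreover have M: "lattice_ideal M" using assms(1) by (simp add: is_value_def)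
  moreover have "M \<subseteq> ?J" by (auto intro: le_supI1)
  ultimately have "?J = M"
    using assms(1) lattice_ideal_adjoin[OF M] unfolding is_value_def by blast
  moreover have "a \<in> ?J" using lattice_idealD(1)[OF M] by auto
  ultimately show False using assms(2) by blast
qed

text \<open>
  If \<open>a\<close> and \<open>b\<close> lie outside a value \<open>M\<close> of \<open>x\<close>, then \<open>x \<le> m \<squnion> a\<close> and \<open>x \<le> m \<squnion> b\<close> for a common
  \<open>m\<close> in \<open>M\<close>.  Distributivity gives \<open>x \<le> m \<squnion> (a \<sqinter> b)\<close>, so \<open>a \<sqinter> b\<close> in \<open>M\<close> would put \<open>x\<close> in \<open>M\<close>.
\<close>

lemma value_imp_prime:
  fixes M :: "'a::distrib_lattice set"
  assumes "is_value x M"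
  shows "prime_lattice_ideal M"
proof -
  have M: "lattice_ideal M" and x: "x \<notin> M" using assms by (auto simp: is_value_def)
  have "a \<in> M \<or> b \<in> M" if ab: "inf a b \<in> M" for a b
  proof (rule ccontr)
    assume "\<not> (a \<in> M \<or> b \<in> M)"
    then obtain m n where mn: "m \<in> M" "x \<le> sup m a" "n \<in> M" "x \<le> sup n b"
      using value_below_adjoin[OF assms] by blast
    have "x \<le> sup (sup m n) a"
      using mn(2) by (rule order_trans) (simp add: le_supI1)
    moreover have "x \<le> sup (sup m n) b"
      using mn(4) by (rule order_trans) (simp add: le_supI1)
    ultimately have "x \<le> sup (sup m n) (inf a b)" by (simp add: sup_inf_distrib1)
    moreover have "sup (sup m n) (inf a b) \<in> M"
      by (intro lattice_idealD(2)[OF M] mn ab)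
    ultimately have "x \<in> M" by (rule lattice_idealD(3)[OF M, rotated])
    with x show False ..
  qed
  with M x show ?thesis by (auto simp: prime_lattice_ideal_def)
qed

lemma Val_subset_Spe: "(Val :: 'a::{distrib_lattice,bounded_lattice_bot} set set) \<subseteq> Spe"
  by (auto simp: Val_def Spe_def intro: value_imp_prime)

lemma ex_Val_above_ideal:
  fixes I :: "'a::bounded_lattice_bot set"
  assumes "lattice_ideal I" and "x \<notin> I"
  shows "\<exists>M\<in>Val. I \<subseteq> M \<and> x \<notin> M"
proof -
  have "bot < x" using assms bot_in_lattice_ideal bot.not_eq_extremum by metis
  then show ?thesis
    using ex_value_above_ideal[OF assms] unfolding Val_def is_value_def by blast
qed

section \<open>Ideals above a prime\<close>

text \<open>
  If \<open>a\<close> is in \<open>Q\<close> but not in \<open>R\<close> and \<open>b\<close> is in \<open>R\<close> but not in \<open>Q\<close>, then \<open>a\<close> and \<open>b\<close> are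
  incomparable.  As \<open>P\<close> is prime, it contains one of their disjoint components, say that of \<open>a\<close>.
  It then lies in \<open>R\<close>, as does \<open>a \<sqinter> b\<close>; so \<open>a\<close>, their join, is in \<open>R\<close> after all.
\<close>

lemma ideals_above_prime_chain:
  fixes P Q R :: "'a::decomposable_lattice set"
  assumes P: "prime_lattice_ideal P" and Q: "lattice_ideal Q" and R: "lattice_ideal R"
    and "P \<subseteq> Q" "P \<subseteq> R"
  shows "Q \<subseteq> R \<or> R \<subseteq> Q"
proof (rule ccontr)
  assume "\<not> (Q \<subseteq> R \<or> R \<subseteq> Q)"
  then obtain a b where a: "a \<in> Q" "a \<notin> R" and b: "b \<in> R" "b \<notin> Q" by blast
  have "\<not> a \<le> b" "\<not> b \<le> a"
    using a(2) b(2) lattice_idealD(3)[OF R b(1)] lattice_idealD(3)[OF Q a(1)] by auto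
  then obtain a' b' where a': "a = sup a' (inf a b)" and b': "b = sup b' (inf a b)"
    and disjoint: "inf a' b' = bot"
    using decomposable by blast
  have "bot \<in> P" using P bot_in_lattice_ideal by (auto simp: prime_lattice_ideal_def)
  with disjoint P have "a' \<in> P \<or> b' \<in> P" unfolding prime_lattice_ideal_def by metis
  moreover have "inf a b \<in> Q" "inf a b \<in> R"
    by (rule lattice_idealD(3)[OF Q a(1)], simp) (rule lattice_idealD(3)[OF R b(1)], simp)
  ultimately have "sup a' (inf a b) \<in> R \<or> sup b' (inf a b) \<in> Q"
    using assms(4,5) lattice_idealD(2)[OF Q, of b'] lattice_idealD(2)[OF R, of a'] by blast
  then have "a \<in> R \<or> b \<in> Q" by (simp flip: a' b')
  with a b show False by blast
qed

section \<open>Descending chains\<close>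

text \<open>
  Monotonicity gives primeness: if \<open>a\<close> is missing from \<open>f i\<close> and \<open>b\<close> from \<open>f j\<close>, then
  both are missing from the single prime ideal with index \<open>max i j\<close>.
\<close>

lemma prime_Inter_decreasing:
  fixes f :: "nat \<Rightarrow> 'a::bounded_lattice_bot set"
  assumes "antimono f" and prime: "\<And>n. prime_lattice_ideal (f n)"
  shows "prime_lattice_ideal (\<Inter>n. f n)"
proof -
  have ideal: "lattice_ideal (f n)" for n using prime by (simp add: prime_lattice_ideal_def)
  have "lattice_ideal (\<Inter>n. f n)"
    unfolding lattice_ideal_def
  proof (intro conjI ballI allI impI)
    show "(\<Inter>n. f n) \<noteq> {}" using bot_in_lattice_ideal[OF ideal] by blast
  next
    fix a b assume "a \<in> (\<Inter>n. f n)" "b \<in> (\<Inter>n. f n)"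
    then show "sup a b \<in> (\<Inter>n. f n)" by (intro INT_I lattice_idealD(2)[OF ideal]) auto
  next
    fix a b assume a: "a \<in> (\<Inter>n. f n)" and "b \<le> a"
    have "b \<in> f n" for n
      using \<open>b \<le> a\<close> by (rule lattice_idealD(3)[OF ideal, rotated]) (use a in blast)
    then show "b \<in> (\<Inter>n. f n)" by blast
  qed
  moreover have "(\<Inter>n. f n) \<noteq> UNIV"
    using prime[of 0] by (auto simp: prime_lattice_ideal_def)
  moreover have "a \<in> (\<Inter>n. f n) \<or> b \<in> (\<Inter>n. f n)" if ab: "inf a b \<in> (\<Inter>n. f n)" for a b
  proof (rule ccontr)
    assume "\<not> (a \<in> (\<Inter>n. f n) \<or> b \<in> (\<Inter>n. f n))"
    then obtain i j where ij: "a \<notin> f i" "b \<notin> f j" by blast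
    have "f (max i j) \<subseteq> f i" "f (max i j) \<subseteq> f j"
      using assms(1) by (simp_all add: antimonoD)
    with ij have "a \<notin> f (max i j)" "b \<notin> f (max i j)" by blast+
    with ab prime[of "max i j"] show False by (auto simp: prime_lattice_ideal_def)
  qed
  ultimately show ?thesis by (simp add: prime_lattice_ideal_def)
qed

lemma dcc_subset: "dcc T \<Longrightarrow> S \<subseteq> T \<Longrightarrow> dcc S"
  unfolding dcc_def by blast

lemma dcc_imp_ex_minimal:
  assumes "dcc S" and "T \<subseteq> S" and "T \<noteq> {}"
  shows "\<exists>m\<in>T. \<forall>t\<in>T. \<not> t < m"
proof (rule ccontr)
  assume "\<not> (\<exists>m\<in>T. \<forall>t\<in>T. \<not> t < m)"
  then have "\<exists>y. y \<in> T \<and> y < x" if "x \<in> T" for x using that by blast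
  then obtain f where f: "\<And>n::nat. f n \<in> T" "\<And>n. f (Suc n) < f n"
    using dependent_nat_choice[of "\<lambda>_ x. x \<in> T" "\<lambda>_ x y. y < x"] assms(3) by blast
  then have "antimono f" by (simp add: antimono_iff_le_Suc less_imp_le)
  with f(1) assms(1,2) obtain n where "\<forall>m\<ge>n. f m = f n" unfolding dcc_def by blast
  then have "f (Suc n) = f n" by (rule allE[where x = "Suc n"]) simp
  with f(2)[of n] show False by simp
qed

lemma Spe_eq_Val_imp_dcc_Spe:
  assumes "(Spe :: 'a::bounded_lattice_bot set set) = Val"
  shows "dcc (Spe :: 'a set set)"
  unfolding dcc_def
proof (intro allI impI)
  fix f :: "nat \<Rightarrow> 'a set"
  assume "range f \<subseteq> Spe" and decr: "antimono f"
  then have prime: "prime_lattice_ideal (f n)" for n by (auto simp: Spe_def)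
  then have "(\<Inter>n. f n) \<in> Val"
    using prime_Inter_decreasing[OF decr] assms by (auto simp: Spe_def)
  then obtain x where x: "is_value x (\<Inter>n. f n)" by (auto simp: Val_def)
  then obtain n where n: "x \<notin> f n" by (auto simp: is_value_def)
  have eq: "f m = (\<Inter>n. f n)" if "n \<le> m" for m
  proof -
    have "f m \<subseteq> f n" using decr that by (rule antimonoD)
    with n have "x \<notin> f m" by blast
    moreover have "lattice_ideal (f m)" using prime by (simp add: prime_lattice_ideal_def)
    ultimately show ?thesis using x unfolding is_value_def by blast
  qed
  have "\<forall>m\<ge>n. f m = f n"
    by (intro allI impI) (rule trans[OF eq eq[OF order_refl, symmetric]])
  then show "\<exists>n. \<forall>m\<ge>n. f m = f n" ..
qed

lemma dcc_Val_imp_Spe_eq_Val: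
  assumes "dcc (Val :: 'a::decomposable_lattice set set)"
  shows "(Spe :: 'a set set) = Val"
proof
  show "(Spe :: 'a set set) \<subseteq> Val"
  proof
    fix P :: "'a set" assume "P \<in> Spe"
    then have P: "prime_lattice_ideal P" by (simp add: Spe_def)
    then have ideal: "lattice_ideal P" and "P \<noteq> UNIV" by (auto simp: prime_lattice_ideal_def)
    let ?T = "{M \<in> Val. P \<subseteq> M}"
    have "?T \<noteq> {}" using \<open>P \<noteq> UNIV\<close> ex_Val_above_ideal[OF ideal] by blast
    then obtain M where M: "M \<in> ?T" and minimal: "\<forall>N\<in>?T. \<not> N < M"
      using dcc_imp_ex_minimal[OF assms, of ?T] by blast
    \<comment> \<open>In the chain of values above \<open>P\<close>, minimal means least.\<close>
    have least: "M \<subseteq> N" if N: "N \<in> ?T" for N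
    proof -
      have "lattice_ideal M" "lattice_ideal N"
        using M N by (auto simp: Val_def is_value_def)
      then have "M \<subseteq> N \<or> N \<subseteq> M"
        using ideals_above_prime_chain[OF P] M N by blast
      with minimal N show ?thesis by blast
    qed
    have "M \<subseteq> P"
    proof
      fix x assume "x \<in> M"
      show "x \<in> P"
      proof (rule ccontr)
        assume "x \<notin> P"
        then obtain N where "N \<in> ?T" "x \<notin> N" using ex_Val_above_ideal[OF ideal] by blast
        with least \<open>x \<in> M\<close> show False by blast
      qed
    qed
    with M show "P \<in> Val" by (metis (lifting) mem_Collect_eq subset_antisym)
  qed
qed (rule Val_subset_Spe)

theorem theorem3p5:
  shows "((Spe :: 'a::decomposable_lattice set set) = Val \<longleftrightarrow> dcc (Val :: 'a set set))
    \<and> (dcc (Val :: 'a set set) \<longleftrightarrow> dcc (Spe :: 'a set set))"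
  using Spe_eq_Val_imp_dcc_Spe dcc_Val_imp_Spe_eq_Val dcc_subset[OF _ Val_subset_Spe] by blast

end
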